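(* Let $\delta_0\in\Sigma_d$ and assume that the inequality $$\delta_0(\omega)\Big(\omega^2\lVert u\rVert_H^2+\lVert A_0^{1/2}u\rVert_H^2\Big)\le\lVert(A_0-\omega^2I)u\rVert_H^2+\lVert C_0u\rVert_Y^2$$ holds for all $\omega\in\mathbb{R}$ and all $u\in H_2$. Then there exists $\delta\in\Sigma_d$ such that the inequality $$\delta(\lambda)\lVert z\rVert_X^2\le\lVert(A-\lambda I)z\rVert_X^2+\lVert Cz\rVert_Y^2$$ is satisfied for all $\lambda\in\mathbb{R}$ and all $z\in D(A)$.
   Context: Setting. $H$ and $Y$ are complex Hilbert spaces. $A_0:D(A_0)\subset H\to H$ is an unbounded self-adjoint positive operator with compact resolvent (all its eigenvalues are positive). For $\beta\ge 0$, $H_\beta=D(A_0^{\beta/2})$ with norm $\|u\|_{H_\beta}=\|A_0^{\beta/2}u\|_H$ (so $H_2=D(A_0)$, $H_1=D(A_0^{1/2})$). $C_0\in\mathcal L(D(A_0),Y)$ is a bounded linear operator. Let $X=H_1\times H$ with the product norm $\|(u,v)\|_X^2=\|A_0^{1/2}u\|_H^2+\|v\|_H^2$, and $$A=-i\begin{pmatrix}0&I\\-A_0&0\end{pmatrix},\quad D(A)=D(A_0)\times H_1,\qquad C=\begin{pmatrix}C_0&0\end{pmatrix}\in\mathcal L(D(A),Y),$$ so $A(u,v)=(-iv,\,iA_0u)$ is self-adjoint on $X$ with compact resolvent, and $C(u,v)=C_0u$. Standing assumption: $C$ is admissible, i.e. for every $T>0$ there is $C_T>0$ with $\int_0^T\|Ce^{itA}z_0\|_Y^2dt\le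 C_T\|z_0\|_X^2$ for all $z_0\in D(A)$. $\Sigma_d$ is the set of functions $\mathbb{R}\to(0,\infty)$ that are even, continuous, and non-increasing on $[0,\infty)$. *)

theory Defs
  imports "HOL-Analysis.Analysis"
begin

class complex_vector = real_vector +
  fixes scaleC :: "complex \<Rightarrow> 'a \<Rightarrow> 'a"  (infixr "*\<^sub>C" 75)
  assumes scaleC_add_right: "a *\<^sub>C (x + y) = a *\<^sub>C x + a *\<^sub>C y"
    and scaleC_add_left: "(a + b) *\<^sub>C x = a *\<^sub>C x + b *\<^sub>C x"
    and scaleC_scaleC: "a *\<^sub>C b *\<^sub>C x = (a * b) *\<^sub>C x"
    and scaleC_one: "1 *\<^sub>C x = x"
    and scaleR_scaleC: "r *\<^sub>R x = complex_of_real r *\<^sub>C x"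

text \<open>The inner product is linear in the second and antilinear in the first argument;
  completeness comes from the class \<open>banach\<close>.\<close>

class complex_hilbert = complex_vector + banach +
  fixes cinner :: "'a \<Rightarrow> 'a \<Rightarrow> complex"
  assumes cinner_commute: "cinner x y = cnj (cinner y x)"
    and cinner_add_right: "cinner x (y + z) = cinner x y + cinner x z"
    and cinner_scaleC_right: "cinner x (a *\<^sub>C y) = a * cinner x y"
    and norm_cinner: "cinner x x = complex_of_real ((norm x)\<^sup>2)"

instantiation complex :: complex_hilbert
begin

definition "scaleC_complex (a::complex) (x::complex) = a * x"
definition "cinner_complex (x::complex) (y::complex) = cnj x * y"

instance
proof
  fix a b x y z :: complex and r :: real
  show "a *\<^sub>C (x + y) = a *\<^sub>C x + a *\<^sub>C y" "(a + b) *\<^sub>C x = a *\<^sub>C x + b *\<^sub>C x"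
    by (simp_all add: scaleC_complex_def distrib_left distrib_right)
  show "a *\<^sub>C b *\<^sub>C x = (a * b) *\<^sub>C x" "1 *\<^sub>C x = x"
    by (simp_all add: scaleC_complex_def)
  show "r *\<^sub>R x = complex_of_real r *\<^sub>C x"
    by (simp add: scaleC_complex_def scaleR_conv_of_real)
  show "cinner x y = cnj (cinner y x)" "cinner x (y + z) = cinner x y + cinner x z"
    "cinner x (a *\<^sub>C y) = a * cinner x y"
    by (simp_all add: cinner_complex_def scaleC_complex_def distrib_left)
  show "cinner x x = complex_of_real ((norm x)\<^sup>2)"
    unfolding cinner_complex_def complex_norm_square by (rule mult.commute)
qed

end

instantiation prod :: (complex_vector, complex_vector) complex_vector
begin

definition "scaleC_prod (a::complex) (x::'a \<times> 'b) = (a *\<^sub>C fst x, a *\<^sub>C snd x)"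

instance
  by standard
    (auto simp: scaleC_prod_def scaleC_add_right scaleC_add_left scaleC_scaleC scaleC_one
      scaleR_scaleC prod_eq_iff)

end

text \<open>An operator with domain \<open>D(A)\<close> is a partial function \<open>A\<close> with \<open>dom A = D(A)\<close>.  In
  particular \<open>S \<circ>\<^sub>m S\<close> is the composition of unbounded operators, with domain
  \<open>{u \<in> D(S). S u \<in> D(S)}\<close>.\<close>

abbreviation op_app :: "('a \<rightharpoonup> 'b) \<Rightarrow> 'a \<Rightarrow> 'b"  (infixl "\<cdot>" 90)
  where "A \<cdot> u \<equiv> the (A u)"

definition csubspace :: "'a::complex_vector set \<Rightarrow> bool"
  where "csubspace D \<longleftrightarrow> 0 \<in> D \<and> (\<forall>x\<in>D. \<forall>y\<in>D. x + y \<in> D) \<and> (\<forall>a. \<forall>x\<in>D. a *\<^sub>C x \<in> D)"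

definition clinear_on :: "'a::complex_vector set \<Rightarrow> ('a \<Rightarrow> 'b::complex_vector) \<Rightarrow> bool"
  where "clinear_on D f \<longleftrightarrow>
    (\<forall>x\<in>D. \<forall>y\<in>D. f (x + y) = f x + f y) \<and> (\<forall>a. \<forall>x\<in>D. f (a *\<^sub>C x) = a *\<^sub>C f x)"

definition linear_operator :: "('a::complex_vector \<rightharpoonup> 'b::complex_vector) \<Rightarrow> bool"
  where "linear_operator A \<longleftrightarrow> csubspace (dom A) \<and> clinear_on (dom A) (\<lambda>x. A \<cdot> x)"

definition densely_defined :: "('h::complex_hilbert \<rightharpoonup> 'h) \<Rightarrow> bool"
  where "densely_defined A \<longleftrightarrow> closure (dom A) = UNIV"

text \<open>The value of the adjoint at \<open>y\<close>, where it exists, is unique if \<open>A\<close> is densely defined.\<close>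

definition adjoint_operator :: "('h::complex_hilbert \<rightharpoonup> 'h) \<Rightarrow> ('h \<rightharpoonup> 'h)"
  where "adjoint_operator A = (\<lambda>y.
    if \<exists>z. \<forall>x\<in>dom A. cinner y (A \<cdot> x) = cinner z x
    then Some (THE z. \<forall>x\<in>dom A. cinner y (A \<cdot> x) = cinner z x)
    else None)"

definition self_adjoint :: "('h::complex_hilbert \<rightharpoonup> 'h) \<Rightarrow> bool"
  where "self_adjoint A \<longleftrightarrow> linear_operator A \<and> densely_defined A \<and> adjoint_operator A = A"

definition nonnegative_operator :: "('h::complex_hilbert \<rightharpoonup> 'h) \<Rightarrow> bool"
  where "nonnegative_operator A \<longleftrightarrow> (\<forall>u\<in>dom A. 0 \<le> Re (cinner u (A \<cdot> u)))"

definition positive_operator :: "('h::complex_hilbert \<rightharpoonup> 'h) \<Rightarrow> bool"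
  where "positive_operator A \<longleftrightarrow> (\<forall>u\<in>dom A. u \<noteq> 0 \<longrightarrow> 0 < Re (cinner u (A \<cdot> u)))"

definition unbounded_operator :: "('h::complex_hilbert \<rightharpoonup> 'h) \<Rightarrow> bool"
  where "unbounded_operator A \<longleftrightarrow> \<not> (\<exists>K. \<forall>u\<in>dom A. norm (A \<cdot> u) \<le> K * norm u)"

definition resolvent :: "('h::complex_hilbert \<rightharpoonup> 'h) \<Rightarrow> complex \<Rightarrow> 'h \<Rightarrow> 'h"
  where "resolvent A \<zeta> = inv_into (dom A) (\<lambda>u. A \<cdot> u - \<zeta> *\<^sub>C u)"

definition resolvent_set :: "('h::complex_hilbert \<rightharpoonup> 'h) \<Rightarrow> complex set"
  where "resolvent_set A = {\<zeta>. bij_betw (\<lambda>u. A \<cdot> u - \<zeta> *\<^sub>C u) (dom A) UNIV \<and>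
    (\<exists>K. \<forall>f. norm (resolvent A \<zeta> f) \<le> K * norm f)}"

definition compact_map :: "('h::complex_hilbert \<Rightarrow> 'h) \<Rightarrow> bool"
  where "compact_map R \<longleftrightarrow> (\<forall>B. bounded B \<longrightarrow> compact (closure (R ` B)))"

definition compact_resolvent :: "('h::complex_hilbert \<rightharpoonup> 'h) \<Rightarrow> bool"
  where "compact_resolvent A \<longleftrightarrow> (\<exists>\<zeta>\<in>resolvent_set A. compact_map (resolvent A \<zeta>))"

text \<open>\<open>A\<^sup>1\<^sup>/\<^sup>2\<close> as the unique nonnegative self-adjoint square root, which exists for every
  nonnegative self-adjoint \<open>A\<close>.\<close>

definition sqrt_operator :: "('h::complex_hilbert \<rightharpoonup> 'h) \<Rightarrow> ('h \<rightharpoonup> 'h)"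
  where "sqrt_operator A = (THE S. self_adjoint S \<and> nonnegative_operator S \<and> S \<circ>\<^sub>m S = A)"

text \<open>The space \<open>X\<close> below is a subspace of \<open>H \<times> H\<close> whose norm is not that of the product type,
  so the carrier \<open>V\<close> and its norm \<open>N\<close> are explicit.\<close>

definition unitary_group ::
    "'x::complex_vector set \<Rightarrow> ('x \<Rightarrow> real) \<Rightarrow> (real \<Rightarrow> 'x \<rightharpoonup> 'x) \<Rightarrow> bool"
  where "unitary_group V N U \<longleftrightarrow>
    (\<forall>t. linear_operator (U t) \<and> dom (U t) = V \<and> ran (U t) \<subseteq> V) \<and>
    U 0 = Some |` V \<and> (\<forall>s t. U (s + t) = U s \<circ>\<^sub>m U t) \<and>
    (\<forall>t. \<forall>z\<in>V. N (U t \<cdot> z) = N z) \<and>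
    (\<forall>z\<in>V. ((\<lambda>t. N (U t \<cdot> z - z)) \<longlongrightarrow> 0) (at 0))"

text \<open>The generator of \<open>U\<close>, with its full domain, is \<open>\<i>A\<close>.\<close>

definition generated_by ::
    "'x::complex_vector set \<Rightarrow> ('x \<Rightarrow> real) \<Rightarrow> ('x \<rightharpoonup> 'x) \<Rightarrow> (real \<Rightarrow> 'x \<rightharpoonup> 'x) \<Rightarrow> bool"
  where "generated_by V N A U \<longleftrightarrow> (\<forall>z w. A z = Some w \<longleftrightarrow>
    z \<in> V \<and> w \<in> V \<and> ((\<lambda>h. N ((1 / h) *\<^sub>R (U h \<cdot> z - z) - \<i> *\<^sub>C w)) \<longlongrightarrow> 0) (at 0))"

text \<open>\<open>t \<mapsto> e\<^sup>i\<^sup>t\<^sup>A\<close>; for \<open>A\<close> self-adjoint on \<open>(V, N)\<close> it exists and is unique by Stone's theorem.\<close>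

definition exp_group ::
    "'x::complex_vector set \<Rightarrow> ('x \<Rightarrow> real) \<Rightarrow> ('x \<rightharpoonup> 'x) \<Rightarrow> (real \<Rightarrow> 'x \<rightharpoonup> 'x)"
  where "exp_group V N A = (THE U. unitary_group V N U \<and> generated_by V N A U)"

definition X_space :: "('h::complex_hilbert \<rightharpoonup> 'h) \<Rightarrow> ('h \<times> 'h) set"
  where "X_space A\<^sub>0 = dom (sqrt_operator A\<^sub>0) \<times> UNIV"

definition X_norm :: "('h::complex_hilbert \<rightharpoonup> 'h) \<Rightarrow> 'h \<times> 'h \<Rightarrow> real"
  where "X_norm A\<^sub>0 = (\<lambda>(u, v). sqrt ((norm (sqrt_operator A\<^sub>0 \<cdot> u))\<^sup>2 + (norm v)\<^sup>2))"

definition A_op :: "('h::complex_hilbert \<rightharpoonup> 'h) \<Rightarrow> ('h \<times> 'h \<rightharpoonup> 'h \<times> 'h)"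
  where "A_op A\<^sub>0 = (\<lambda>(u, v).
    if u \<in> dom A\<^sub>0 \<and> v \<in> dom (sqrt_operator A\<^sub>0)
    then Some (- (\<i> *\<^sub>C v), \<i> *\<^sub>C (A\<^sub>0 \<cdot> u))
    else None)"

definition C_op :: "('h \<Rightarrow> 'y) \<Rightarrow> 'h \<times> 'h \<Rightarrow> 'y"
  where "C_op C\<^sub>0 = (\<lambda>(u, v). C\<^sub>0 u)"

text \<open>\<open>C\<^sub>0 \<in> L(D(A\<^sub>0), Y)\<close>, where \<open>D(A\<^sub>0)\<close> carries the norm \<open>\<parallel>A\<^sub>0 u\<parallel>\<close>; values of \<open>C\<^sub>0\<close> outside
  \<open>D(A\<^sub>0)\<close> are irrelevant.\<close>

definition bounded_observation ::
    "('h::complex_hilbert \<rightharpoonup> 'h) \<Rightarrow> ('h \<Rightarrow> 'y::complex_hilbert) \<Rightarrow> bool"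
  where "bounded_observation A\<^sub>0 C\<^sub>0 \<longleftrightarrow> clinear_on (dom A\<^sub>0) C\<^sub>0 \<and>
    (\<exists>K. \<forall>u\<in>dom A\<^sub>0. norm (C\<^sub>0 u) \<le> K * norm (A\<^sub>0 \<cdot> u))"

definition admissible ::
    "('h::complex_hilbert \<rightharpoonup> 'h) \<Rightarrow> ('h \<Rightarrow> 'y::complex_hilbert) \<Rightarrow> bool"
  where "admissible A\<^sub>0 C\<^sub>0 \<longleftrightarrow> (\<forall>T>0. \<exists>C\<^sub>T>0. \<forall>z\<^sub>0\<in>dom (A_op A\<^sub>0).
    let f = (\<lambda>t. (norm (C_op C\<^sub>0 (exp_group (X_space A\<^sub>0) (X_norm A\<^sub>0) (A_op A\<^sub>0) t \<cdot> z\<^sub>0)))\<^sup>2)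
    in f integrable_on {0..T} \<and> integral {0..T} f \<le> C\<^sub>T * (X_norm A\<^sub>0 z\<^sub>0)\<^sup>2)"

definition Sigma_d :: "(real \<Rightarrow> real) set"
  where "Sigma_d = {\<delta>. (\<forall>x. 0 < \<delta> x) \<and> (\<forall>x. \<delta> (- x) = \<delta> x) \<and>
    continuous_on UNIV \<delta> \<and> antimono_on {0..} \<delta>}"

end

theory Submission
  imports Defs
begin

text \<open>
  Write \<open>S = A\<^sub>0\<^sup>1\<^sup>/\<^sup>2\<close>.  For \<open>z = (u, v) \<in> D(A)\<close> and real \<open>l\<close> put \<open>(f, g) = (A - l) z\<close>, that is
  \<open>f = - \<i> v - l u\<close> and \<open>g = \<i> A\<^sub>0 u - l v\<close>.  Eliminating \<open>v = \<i> (f + l u)\<close> gives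
  \<open>(A\<^sub>0 - l\<^sup>2) u = l f - \<i> g\<close>, so the second order inequality at \<open>\<omega> = l\<close> bounds \<open>u\<close>, and then \<open>v\<close>,
  in terms of \<open>\<parallel>f\<parallel>\<close>, \<open>\<parallel>g\<parallel>\<close> and \<open>\<parallel>C\<^sub>0 u\<parallel>\<close>.  The norm of \<open>X\<close> controls \<open>\<parallel>S f\<parallel>\<close> and not \<open>\<parallel>f\<parallel>\<close>,
  so the Poincare type inequality \<open>\<parallel>f\<parallel>\<^sup>2 \<le> b \<parallel>S f\<parallel>\<^sup>2\<close> is needed; it holds with \<open>b = \<parallel>S\<^sup>-\<^sup>1\<parallel>\<^sup>2\<close>.
  The function \<open>\<delta> l = 1 / (4 (1 + b l\<^sup>2) / \<delta>\<^sub>0 l + 2 b)\<close> then works.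

  The bulk of the work is to show that \<open>S\<close>, specified as the unique nonnegative self-adjoint
  operator with \<open>S\<^sup>2 = A\<^sub>0\<close>, exists, is unique and has a bounded inverse.  By compactness of the
  resolvent, a positive \<open>A\<^sub>0\<close> is bounded below (\<open>compact_resolvent_bounded_below\<close>); being
  self-adjoint it is then onto, since its range is closed and the orthogonal complement of the
  range is the kernel (\<open>self_adjoint_bounded_below_surj\<close>).  Hence \<open>T = A\<^sub>0\<^sup>-\<^sup>1\<close> is a bounded positive
  operator, and everything reduces to the square root of a bounded positive operator, which
  exists by a monotone iteration (\<open>positive_bounded_sqrt_exists\<close>) and is unique
  (\<open>commuting_sqrt_unique\<close>).  The inverse of that root is \<open>S\<close>
  (\<open>sqrt_operator_bounded_inverse\<close>).
\<close>

section \<open>Complex inner products\<close>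

lemma scaleC_zero_right [simp]: "a *\<^sub>C 0 = 0"
  using scaleC_add_right[of a 0 0] by simp

lemma scaleC_minus_right: "a *\<^sub>C (- x) = - (a *\<^sub>C x)"
  using scaleC_add_right[of a x "- x"] by (simp add: eq_neg_iff_add_eq_0 add.commute)

lemma scaleC_diff_right: "a *\<^sub>C (x - y) = a *\<^sub>C x - a *\<^sub>C y"
  using scaleC_add_right[of a x "- y"] by (simp add: scaleC_minus_right)

lemma scaleC_scaleR: "a *\<^sub>C (r *\<^sub>R x) = r *\<^sub>R (a *\<^sub>C x)"
  by (simp add: scaleR_scaleC scaleC_scaleC mult.commute)

lemma ii_scaleC_ii_scaleC: "\<i> *\<^sub>C (\<i> *\<^sub>C x) = - x"
  using scaleR_scaleC[of "-1" x] by (simp add: scaleC_scaleC)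

lemma cinner_add_left: "cinner (x + y) z = cinner x z + cinner y z"
  by (metis cinner_commute cinner_add_right complex_cnj_add)

lemma cinner_scaleC_left: "cinner (a *\<^sub>C x) y = cnj a * cinner x y"
  by (metis cinner_commute cinner_scaleC_right complex_cnj_mult)

lemma cinner_scaleR_right: "cinner x (r *\<^sub>R y) = of_real r * cinner x y"
  by (simp add: scaleR_scaleC cinner_scaleC_right)

lemma cinner_scaleR_left: "cinner (r *\<^sub>R x) y = of_real r * cinner x y"
  by (simp add: scaleR_scaleC cinner_scaleC_left)

lemma cinner_zero_right [simp]: "cinner x 0 = 0"
  using cinner_scaleR_right[of x 0 0] by simp

lemma cinner_zero_left [simp]: "cinner 0 x = 0"
  using cinner_scaleR_left[of 0 0 x] by simp

lemma cinner_minus_right: "cinner x (- y) = - cinner x y"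
  using cinner_scaleR_right[of x "-1" y] by simp

lemma cinner_minus_left: "cinner (- x) y = - cinner x y"
  using cinner_scaleR_left[of "-1" x y] by simp

lemma cinner_diff_right: "cinner x (y - z) = cinner x y - cinner x z"
  using cinner_add_right[of x y "- z"] by (simp add: cinner_minus_right)

lemma cinner_diff_left: "cinner (x - y) z = cinner x z - cinner y z"
  using cinner_add_left[of x "- y" z] by (simp add: cinner_minus_left)

lemmas cinner_simps = cinner_add_left cinner_add_right cinner_diff_left cinner_diff_right
  cinner_minus_left cinner_minus_right cinner_scaleR_left cinner_scaleR_right
  cinner_scaleC_left cinner_scaleC_right

lemma Re_cinner_self: "Re (cinner x x) = (norm x)\<^sup>2"
  by (simp add: norm_cinner)

lemma Re_cinner_commute: "Re (cinner x y) = Re (cinner y x)"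
  by (subst cinner_commute) simp

lemma cinner_self_eq_0D: "cinner x x = 0 \<Longrightarrow> x = 0"
  by (simp add: norm_cinner)

lemma norm_scaleC: "norm (a *\<^sub>C (x::'a::complex_hilbert)) = cmod a * norm x"
proof -
  have "(norm (a *\<^sub>C x))\<^sup>2 = Re (cnj a * a * cinner x x)"
    by (simp add: Re_cinner_self[symmetric] cinner_simps mult_ac)
  also have "\<dots> = (cmod a * norm x)\<^sup>2"
    by (simp add: norm_cinner complex_mult_cnj cmod_power2 power_mult_distrib mult.commute[of "cnj a"]
      flip: of_real_mult of_real_power)
  finally show ?thesis by simp
qed

lemma power2_norm_add:
  "(norm (x + y :: 'a::complex_hilbert))\<^sup>2 = (norm x)\<^sup>2 + 2 * Re (cinner x y) + (norm y)\<^sup>2"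
  using Re_cinner_commute[of x y]
  by (simp add: Re_cinner_self[symmetric] cinner_simps)

lemma power2_norm_diff:
  "(norm (x - y :: 'a::complex_hilbert))\<^sup>2 = (norm x)\<^sup>2 - 2 * Re (cinner x y) + (norm y)\<^sup>2"
  using Re_cinner_commute[of x y]
  by (simp add: Re_cinner_self[symmetric] cinner_simps)

lemma power2_norm_add_le:
  "(norm (x + y :: 'a::complex_hilbert))\<^sup>2 \<le> 2 * (norm x)\<^sup>2 + 2 * (norm y)\<^sup>2"
  using power2_norm_add[of x y] power2_norm_diff[of x y] zero_le_power2[of "norm (x - y)"]
  by linarith

text \<open>The quadratic \<open>a \<mapsto> \<parallel>x - a y\<parallel>\<^sup>2\<close> is minimal at \<open>a = \<langle>y, x\<rangle> / \<parallel>y\<parallel>\<^sup>2\<close>.\<close>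

lemma power2_norm_diff_projection:
  fixes x y :: "'a::complex_hilbert"
  assumes "y \<noteq> 0"
  shows "(norm (x - (cinner y x / of_real ((norm y)\<^sup>2)) *\<^sub>C y))\<^sup>2 =
    (norm x)\<^sup>2 - (cmod (cinner y x))\<^sup>2 / (norm y)\<^sup>2"
proof -
  define a where "a = cinner y x / of_real ((norm y)\<^sup>2)"
  have "cinner x (a *\<^sub>C y) = cinner y x * cnj (cinner y x) / of_real ((norm y)\<^sup>2)"
    unfolding a_def cinner_scaleC_right by (subst cinner_commute[of x y]) simp
  also have "\<dots> = of_real ((cmod (cinner y x))\<^sup>2 / (norm y)\<^sup>2)"
    unfolding of_real_divide complex_norm_square[of "cinner y x"] ..
  finally have "Re (cinner x (a *\<^sub>C y)) = (cmod (cinner y x))\<^sup>2 / (norm y)\<^sup>2"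
    by (simp only: Re_complex_of_real)
  moreover have "(norm (a *\<^sub>C y))\<^sup>2 = (cmod (cinner y x))\<^sup>2 / (norm y)\<^sup>2"
    using assms unfolding a_def norm_scaleC norm_divide norm_of_real
    by (simp add: field_simps power2_eq_square)
  ultimately show ?thesis
    unfolding power2_norm_diff a_def[symmetric] by simp
qed

lemma Cauchy_Schwarz_cinner: "cmod (cinner x y) \<le> norm x * norm (y :: 'a::complex_hilbert)"
proof (cases "x = 0")
  case False
  then have "0 \<le> (norm y)\<^sup>2 - (cmod (cinner x y))\<^sup>2 / (norm x)\<^sup>2"
    using power2_norm_diff_projection[of x y] by (metis zero_le_power2)
  then have "(cmod (cinner x y))\<^sup>2 \<le> (norm x * norm y)\<^sup>2"
    using False by (simp add: field_simps power_mult_distrib)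
  then show ?thesis by (rule power2_le_imp_le) simp
qed simp

lemma bounded_bilinear_cinner:
  "bounded_bilinear (cinner :: 'a::complex_hilbert \<Rightarrow> 'a \<Rightarrow> complex)"
proof
  show "\<exists>K. \<forall>a b :: 'a. cmod (cinner a b) \<le> norm a * norm b * K"
    by (intro exI[of _ 1]) (simp add: Cauchy_Schwarz_cinner)
qed (simp_all add: cinner_simps scaleR_conv_of_real)

lemmas tendsto_cinner = bounded_bilinear.tendsto[OF bounded_bilinear_cinner]
lemmas continuous_on_cinner = bounded_bilinear.continuous_on[OF bounded_bilinear_cinner]

text \<open>The values of an adjoint are determined by testing against a dense domain.\<close>

lemma dense_cinner_eqI:
  fixes y z :: "'a::complex_hilbert"
  assumes "closure D = UNIV" and "\<And>x. x \<in> D \<Longrightarrow> cinner y x = cinner z x"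
  shows "y = z"
proof -
  have "cinner (y - z) x = 0" for x
  proof (rule continuous_constant_on_closure[of D "cinner (y - z)"])
    show "continuous_on (closure D) (cinner (y - z))"
      by (intro continuous_on_cinner continuous_on_id continuous_on_const)
  qed (use assms in \<open>auto simp: cinner_simps\<close>)
  from cinner_self_eq_0D[OF this] show ?thesis by simp
qed

lemma cinner_eqI: "(\<And>x. cinner y x = cinner z x) \<Longrightarrow> y = (z :: 'a::complex_hilbert)"
  by (rule dense_cinner_eqI[of UNIV]) simp_all

text \<open>A minimising sequence for the distance from \<open>f\<close> to \<open>M\<close> is Cauchy by the parallelogram
  identity, and at a point of minimal distance the first variation vanishes.\<close>

lemma orthogonal_projection_exists:
  fixes f :: "'a::complex_hilbert"
  assumes M: "csubspace M" and "closed M"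
  obtains w where "w \<in> M" "\<And>m. m \<in> M \<Longrightarrow> cinner m (f - w) = 0"
proof -
  have zero: "0 \<in> M" and add: "\<And>x y. x \<in> M \<Longrightarrow> y \<in> M \<Longrightarrow> x + y \<in> M"
    and scale: "\<And>a x. x \<in> M \<Longrightarrow> a *\<^sub>C x \<in> M"
    using M by (auto simp: csubspace_def)
  define d where "d = (INF m\<in>M. (norm (f - m))\<^sup>2)"
  have bdd: "bdd_below ((\<lambda>m. (norm (f - m))\<^sup>2) ` M)"
    by (rule bdd_belowI[of _ 0]) auto
  have le: "d \<le> (norm (f - m))\<^sup>2" if "m \<in> M" for m
    unfolding d_def using bdd that by (rule cINF_lower)
  have "\<exists>m\<in>M. (norm (f - m))\<^sup>2 < d + 1 / Suc n" for n
  proof -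
    have "d < d + 1 / Suc n" by simp
    with zero show ?thesis
      unfolding d_def by (subst (asm) cINF_less_iff[OF _ bdd]) auto
  qed
  then obtain w where w: "\<And>n. w n \<in> M" "\<And>n. (norm (f - w n))\<^sup>2 < d + 1 / Suc n"
    by metis
  have close: "(norm (w m - w n))\<^sup>2 \<le> 2 / Suc m + 2 / Suc n" for m n
  proof -
    have "(1/2) *\<^sub>R (w m + w n) \<in> M"
      unfolding scaleR_scaleC using w(1) add scale by blast
    from le[OF this] have "d \<le> (norm (f - (1/2) *\<^sub>R (w m + w n)))\<^sup>2" .
    also have "f - (1/2) *\<^sub>R (w m + w n) = (1/2) *\<^sub>R ((f + f) - (w m + w n))"
      by (simp only: scaleR_right_diff_distrib scaleR_half_double)
    also have "(f + f) - (w m + w n) = (f - w m) + (f - w n)" by simp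
    also have "(norm ((1/2) *\<^sub>R ((f - w m) + (f - w n))))\<^sup>2 = (norm ((f - w m) + (f - w n)))\<^sup>2 / 4"
      unfolding norm_scaleR by (simp add: power2_eq_square)
    finally have "4 * d \<le> (norm ((f - w m) + (f - w n)))\<^sup>2" by simp
    moreover have "(norm (w m - w n))\<^sup>2 = (norm ((f - w n) - (f - w m)))\<^sup>2"
      by simp
    ultimately show ?thesis
      using w(2)[of m] w(2)[of n] power2_norm_add[of "f - w n" "f - w m"]
        power2_norm_diff[of "f - w n" "f - w m"]
      by (simp add: add.commute)
  qed
  have "Cauchy w"
  proof (rule metric_CauchyI)
    fix e :: real assume "0 < e"
    then obtain N where N: "4 / e\<^sup>2 < real N" using reals_Archimedean2 by blast
    have "dist (w m) (w n) < e" if "N \<le> m" "N \<le> n" for m n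
    proof -
      have "2 / real (Suc m) \<le> 2 / real (Suc N)" "2 / real (Suc n) \<le> 2 / real (Suc N)"
        using that by (auto intro!: divide_left_mono)
      then have "(norm (w m - w n))\<^sup>2 \<le> 4 / Suc N" using close[of m n] by simp
      also have "\<dots> < e\<^sup>2"
      proof -
        have "4 < real N * e\<^sup>2" using N \<open>0 < e\<close> by (simp add: field_simps)
        also have "\<dots> \<le> real (Suc N) * e\<^sup>2" by (intro mult_right_mono) simp_all
        finally show ?thesis
          by (subst pos_divide_less_eq) (simp_all only: of_nat_0_less_iff zero_less_Suc mult.commute)
      qed
      finally show ?thesis
        unfolding dist_norm using \<open>0 < e\<close> by (intro power_less_imp_less_base[of _ 2 e]) auto
    qed
    then show "\<exists>N. \<forall>m\<ge>N. \<forall>n\<ge>N. dist (w m) (w n) < e" by blast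
  qed
  then obtain l where l: "w \<longlonglongrightarrow> l" using Cauchy_convergent convergent_def by blast
  have "l \<in> M" using \<open>closed M\<close> w(1) l closed_sequentially by blast
  have "(\<lambda>n. (norm (f - w n))\<^sup>2) \<longlonglongrightarrow> (norm (f - l))\<^sup>2" by (intro tendsto_intros l)
  moreover have "(\<lambda>n. d + 1 / real (Suc n)) \<longlonglongrightarrow> d + 0"
    by (intro tendsto_intros LIMSEQ_Suc lim_const_over_n)
  ultimately have "(norm (f - l))\<^sup>2 \<le> d + 0"
    by (rule LIMSEQ_le) (use w(2) less_imp_le in blast)
  then have min: "(norm (f - l))\<^sup>2 \<le> d" by simp
  have "cinner m (f - l) = 0" if "m \<in> M" for m
  proof (cases "m = 0")
    case False
    define a where "a = cinner m (f - l) / of_real ((norm m)\<^sup>2)"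
    have "d \<le> (norm (f - (l + a *\<^sub>C m)))\<^sup>2"
      by (intro le add scale \<open>l \<in> M\<close> that)
    also have "\<dots> = (norm (f - l))\<^sup>2 - (cmod (cinner m (f - l)))\<^sup>2 / (norm m)\<^sup>2"
      using power2_norm_diff_projection[OF False, of "f - l"]
      by (simp add: a_def diff_diff_add)
    finally have "(cmod (cinner m (f - l)))\<^sup>2 / (norm m)\<^sup>2 \<le> 0" using min by simp
    then show ?thesis using False by (simp add: divide_le_0_iff)
  qed simp
  with \<open>l \<in> M\<close> show ?thesis by (rule that)
qed

section \<open>Square roots of bounded positive operators\<close>

definition positive_bounded :: "('h::complex_hilbert \<Rightarrow>\<^sub>L 'h) \<Rightarrow> bool"
  where "positive_bounded K \<longleftrightarrow>
    (\<forall>x y. cinner (K x) y = cinner x (K y)) \<and> (\<forall>x. 0 \<le> Re (cinner x (K x)))"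

text \<open>Evaluate the quadratic form of \<open>K\<close> at \<open>x - K x / k\<close>.\<close>

lemma positive_bounded_norm_le:
  fixes K :: "'h::complex_hilbert \<Rightarrow>\<^sub>L 'h"
  assumes K: "positive_bounded K" and k: "0 < k" "norm K \<le> k"
  shows "(norm (K x))\<^sup>2 \<le> k * Re (cinner x (K x))"
proof -
  define t where "t = 1 / k"
  have sym: "cinner (K x) y = cinner x (K y)" for x y
    using K by (simp add: positive_bounded_def)
  have "Re (cinner (K x) (K (K x))) \<le> cmod (cinner (K x) (K (K x)))"
    by (rule complex_Re_le_cmod)
  also have "\<dots> \<le> norm (K x) * norm (K (K x))" by (rule Cauchy_Schwarz_cinner)
  also have "\<dots> \<le> norm (K x) * (k * norm (K x))"
    using order_trans[OF norm_blinfun[of K "K x"] mult_right_mono[OF k(2)]]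
    by (intro mult_left_mono) simp_all
  finally have *: "Re (cinner (K x) (K (K x))) \<le> k * (norm (K x))\<^sup>2"
    by (simp add: power2_eq_square mult_ac)
  have "0 \<le> Re (cinner (x - t *\<^sub>R K x) (K (x - t *\<^sub>R K x)))"
    using K by (simp add: positive_bounded_def)
  also have "\<dots> = Re (cinner x (K x)) - 2 * t * (norm (K x))\<^sup>2
      + t\<^sup>2 * Re (cinner (K x) (K (K x)))"
    by (simp add: blinfun.diff_right blinfun.scaleR_right cinner_simps sym
      Re_cinner_self[symmetric] power2_eq_square[of t] algebra_simps)
  also have "\<dots> \<le> Re (cinner x (K x)) - 2 * t * (norm (K x))\<^sup>2 + t\<^sup>2 * (k * (norm (K x))\<^sup>2)"
    by (intro add_left_mono mult_left_mono *) simp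
  also have "\<dots> = Re (cinner x (K x)) - (norm (K x))\<^sup>2 / k"
    using k by (simp add: t_def field_simps power2_eq_square)
  finally show ?thesis using k by (simp add: field_simps)
qed

text \<open>A square root \<open>1 - Y\<close> of \<open>1 - B\<close> is the same as a solution of \<open>Y = (B + Y\<^sup>2) / 2\<close>, which is found
  by fixed point iteration from \<open>0\<close>.  The case \<open>B = 1\<close> of numbers dominates the case of operators
  with \<open>\<parallel>B\<parallel> \<le> 1\<close>, both for the iterates and for their increments, so that convergence in norm
  follows from the convergence of a monotone sequence of numbers.\<close>

primrec sqrt_iter :: "('h::complex_hilbert \<Rightarrow>\<^sub>L 'h) \<Rightarrow> nat \<Rightarrow> ('h \<Rightarrow>\<^sub>L 'h)"
  where "sqrt_iter B 0 = 0"
  | "sqrt_iter B (Suc n) = (1/2) *\<^sub>R (B + (sqrt_iter B n o\<^sub>L sqrt_iter B n))"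

primrec sqrt_iter_bound :: "nat \<Rightarrow> real"
  where "sqrt_iter_bound 0 = 0"
  | "sqrt_iter_bound (Suc n) = (1 + (sqrt_iter_bound n)\<^sup>2) / 2"

lemma sqrt_iter_bound_range: "0 \<le> sqrt_iter_bound n \<and> sqrt_iter_bound n \<le> 1"
  by (induction n) (auto simp: power_le_one)

lemma Cauchy_sqrt_iter_bound: "Cauchy sqrt_iter_bound"
proof -
  have "sqrt_iter_bound n \<le> sqrt_iter_bound (Suc n)" for n
    using zero_le_power2[of "sqrt_iter_bound n - 1"] by (simp add: power2_eq_square algebra_simps)
  then have "incseq sqrt_iter_bound" by (rule incseq_SucI)
  then have "convergent sqrt_iter_bound"
    using sqrt_iter_bound_range by (metis incseq_convergent convergentI)
  then show ?thesis by (rule convergent_Cauchy)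
qed

lemma sqrt_iter_commute:
  fixes B :: "'h::complex_hilbert \<Rightarrow>\<^sub>L 'h"
  assumes "Z o\<^sub>L B = B o\<^sub>L Z"
  shows "Z o\<^sub>L sqrt_iter B n = sqrt_iter B n o\<^sub>L Z"
proof (induction n)
  case (Suc n)
  have Z: "Z (B x) = B (Z x)" "Z (sqrt_iter B n x) = sqrt_iter B n (Z x)" for x
    using arg_cong[OF assms, of "\<lambda>F. blinfun_apply F x"]
      arg_cong[OF Suc, of "\<lambda>F. blinfun_apply F x"] by simp_all
  show ?case
    by (rule blinfun_eqI) (simp add: blinfun.add_left blinfun.add_right blinfun.scaleR_left
      blinfun.scaleR_right Z)
qed simp

lemma sqrt_iter_symmetric:
  fixes B :: "'h::complex_hilbert \<Rightarrow>\<^sub>L 'h"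
  assumes "\<And>x y. cinner (B x) y = cinner x (B y)"
  shows "cinner (sqrt_iter B n x) y = cinner x (sqrt_iter B n y)"
  by (induction n arbitrary: x y)
    (simp_all add: blinfun.add_left blinfun.scaleR_left cinner_simps assms)

lemma norm_sqrt_iter:
  fixes B :: "'h::complex_hilbert \<Rightarrow>\<^sub>L 'h"
  assumes "norm B \<le> 1"
  shows "norm (sqrt_iter B n) \<le> sqrt_iter_bound n"
proof (induction n)
  case (Suc n)
  have "norm (sqrt_iter B n o\<^sub>L sqrt_iter B n) \<le> (sqrt_iter_bound n)\<^sup>2"
    using norm_blinfun_compose[of "sqrt_iter B n" "sqrt_iter B n"] Suc
    by (smt (verit) mult_mono norm_ge_zero power2_eq_square)
  then show ?case
    using assms norm_triangle_ineq[of B "sqrt_iter B n o\<^sub>L sqrt_iter B n"] by simp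
qed simp

text \<open>The iterates are polynomials in \<open>B\<close> and hence commute, so the difference of two squares
  factorises and the increments satisfy the recursion of their numerical majorants.\<close>

lemma norm_sqrt_iter_step:
  fixes B :: "'h::complex_hilbert \<Rightarrow>\<^sub>L 'h"
  assumes "norm B \<le> 1"
  shows "norm (sqrt_iter B (Suc n) - sqrt_iter B n)
    \<le> sqrt_iter_bound (Suc n) - sqrt_iter_bound n"
proof (induction n)
  case 0
  then show ?case using assms by simp
next
  case (Suc n)
  let ?Y = "sqrt_iter B" and ?y = sqrt_iter_bound
  have "?Y (Suc n) o\<^sub>L ?Y n = ?Y n o\<^sub>L ?Y (Suc n)"
    by (intro sqrt_iter_commute sqrt_iter_commute[symmetric]) (rule refl)
  then have comm: "?Y (Suc n) (?Y n x) = ?Y n (?Y (Suc n) x)" for x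
    by (metis blinfun_apply_blinfun_compose)
  have "?Y (Suc (Suc n)) - ?Y (Suc n) =
      (1/2) *\<^sub>R (B + (?Y (Suc n) o\<^sub>L ?Y (Suc n))) - (1/2) *\<^sub>R (B + (?Y n o\<^sub>L ?Y n))"
    by simp
  also have "\<dots> = (1/2) *\<^sub>R ((?Y (Suc n) - ?Y n) o\<^sub>L (?Y (Suc n) + ?Y n))"
    by (rule blinfun_eqI) (simp add: blinfun.add_left blinfun.add_right blinfun.diff_left
      blinfun.diff_right blinfun.scaleR_left scaleR_right_diff_distrib scaleR_right_distrib comm
      del: sqrt_iter.simps)
  also have "norm \<dots> \<le> (1/2) * (norm (?Y (Suc n) - ?Y n) * norm (?Y (Suc n) + ?Y n))"
    using norm_blinfun_compose[of "?Y (Suc n) - ?Y n" "?Y (Suc n) + ?Y n"] by simp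
  also have "\<dots> \<le> (1/2) * ((?y (Suc n) - ?y n) * (?y (Suc n) + ?y n))"
  proof -
    have "norm (?Y (Suc n) + ?Y n) \<le> ?y (Suc n) + ?y n"
      using norm_sqrt_iter[OF assms, of n] norm_sqrt_iter[OF assms, of "Suc n"]
        norm_triangle_ineq[of "?Y (Suc n)" "?Y n"] by linarith
    moreover have "0 \<le> ?y (Suc n) - ?y n" using Suc norm_ge_zero order_trans by blast
    ultimately have "norm (?Y (Suc n) - ?Y n) * norm (?Y (Suc n) + ?Y n)
        \<le> (?y (Suc n) - ?y n) * (?y (Suc n) + ?y n)"
      using Suc by (intro mult_mono) simp_all
    then show ?thesis by (rule mult_left_mono) simp
  qed
  also have "\<dots> = (1 + (?y (Suc n))\<^sup>2) / 2 - (1 + (?y n)\<^sup>2) / 2"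
    by (simp add: power2_eq_square algebra_simps del: sqrt_iter_bound.simps)
  also have "\<dots> = ?y (Suc (Suc n)) - ?y (Suc n)" by simp
  finally show ?case .
qed

lemma norm_sqrt_iter_diff:
  fixes B :: "'h::complex_hilbert \<Rightarrow>\<^sub>L 'h"
  assumes "norm B \<le> 1" and "n \<le> m"
  shows "norm (sqrt_iter B m - sqrt_iter B n) \<le> sqrt_iter_bound m - sqrt_iter_bound n"
  using assms(2)
proof (induction m rule: dec_induct)
  case (step m)
  then show ?case
    using norm_sqrt_iter_step[OF assms(1), of m]
      norm_triangle_ineq[of "sqrt_iter B (Suc m) - sqrt_iter B m" "sqrt_iter B m - sqrt_iter B n"]
    by simp
qed simp

lemma convergent_sqrt_iter:
  fixes B :: "'h::complex_hilbert \<Rightarrow>\<^sub>L 'h"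
  assumes "norm B \<le> 1"
  shows "convergent (sqrt_iter B)"
proof -
  have "Cauchy (sqrt_iter B)"
  proof (rule metric_CauchyI)
    fix e :: real assume "0 < e"
    with Cauchy_sqrt_iter_bound obtain N where
      N: "\<And>m n. N \<le> m \<Longrightarrow> N \<le> n \<Longrightarrow> dist (sqrt_iter_bound m) (sqrt_iter_bound n) < e"
      unfolding Cauchy_def by blast
    have "dist (sqrt_iter B m) (sqrt_iter B n) < e" if "N \<le> m" "N \<le> n" for m n
    proof (cases "n \<le> m")
      case True
      then show ?thesis
        using norm_sqrt_iter_diff[OF assms True] N[OF that] by (simp add: dist_norm)
    next
      case False
      then show ?thesis
        using norm_sqrt_iter_diff[OF assms, of m n] N[OF that]
        by (simp add: dist_norm norm_minus_commute)
    qed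
    then show "\<exists>N. \<forall>m\<ge>N. \<forall>n\<ge>N. dist (sqrt_iter B m) (sqrt_iter B n) < e" by blast
  qed
  then show ?thesis by (rule Cauchy_convergent)
qed

text \<open>The commutation property holds because the root is a limit of polynomials in \<open>K\<close>; it is what
  makes the uniqueness argument work.\<close>

lemma contraction_sqrt_exists:
  fixes K :: "'h::complex_hilbert \<Rightarrow>\<^sub>L 'h"
  assumes K: "positive_bounded K" and "norm K \<le> 1"
  obtains R where "positive_bounded R" "R o\<^sub>L R = K"
    "\<And>Z. Z o\<^sub>L K = K o\<^sub>L Z \<Longrightarrow> Z o\<^sub>L R = R o\<^sub>L Z"
proof -
  define B where "B = id_blinfun - K"
  have B_apply: "B x = x - K x" for x by (simp add: B_def blinfun.diff_left)
  have sym: "cinner (B x) y = cinner x (B y)" for x y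
    using K by (simp add: B_apply cinner_simps positive_bounded_def)
  \<comment> \<open>From \<open>\<parallel>K x\<parallel>\<^sup>2 \<le> \<langle>x, K x\<rangle>\<close>: \<open>\<parallel>x - K x\<parallel>\<^sup>2 \<le> \<parallel>x\<parallel>\<^sup>2 - \<langle>x, K x\<rangle>\<close>.\<close>
  have B: "norm B \<le> 1"
  proof (rule norm_blinfun_bound)
    fix x
    have "(norm (B x))\<^sup>2 \<le> (norm x)\<^sup>2"
      using positive_bounded_norm_le[OF K _ assms(2), of x] K
      by (simp add: B_apply power2_norm_diff positive_bounded_def) (smt (verit))
    then show "norm (B x) \<le> 1 * norm x" by (simp add: power2_le_iff_abs_le)
  qed simp
  obtain Y where Y: "sqrt_iter B \<longlonglongrightarrow> Y"
    using convergent_sqrt_iter[OF B] convergent_def by blast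
  note tendsto_comp = bounded_bilinear.tendsto[OF bounded_bilinear_blinfun_compose]
  have "(\<lambda>n. sqrt_iter B (Suc n)) \<longlonglongrightarrow> (1/2) *\<^sub>R (B + (Y o\<^sub>L Y))"
    unfolding sqrt_iter.simps by (intro tendsto_intros tendsto_comp Y)
  then have "Y = (1/2) *\<^sub>R (B + (Y o\<^sub>L Y))"
    using LIMSEQ_Suc[OF Y] LIMSEQ_unique by blast
  then have "2 *\<^sub>R Y = B + (Y o\<^sub>L Y)"
    by (metis (no_types, lifting) divide_self_if mult.commute mult.right_neutral scaleR_one
      scaleR_scaleR times_divide_eq_right zero_neq_numeral)
  from arg_cong[OF this, of blinfun_apply] have fix_Y: "Y x + Y x = B x + Y (Y x)" for x
    by (simp add: fun_eq_iff blinfun.add_left blinfun.scaleR_left scaleR_2)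
  define R where "R = id_blinfun - Y"
  have R_apply: "R x = x - Y x" for x by (simp add: R_def blinfun.diff_left)
  have RR: "R o\<^sub>L R = K"
  proof (rule blinfun_eqI)
    fix x
    show "(R o\<^sub>L R) x = K x"
      using fix_Y[of x] by (simp add: R_apply B_apply blinfun.diff_right algebra_simps)
  qed
  have lim: "(\<lambda>n. sqrt_iter B n x) \<longlonglongrightarrow> Y x" for x
    by (intro blinfun.tendsto Y tendsto_const)
  have "cinner (Y x) y = cinner x (Y y)" for x y
    using tendsto_cinner[OF lim[of x] tendsto_const[of y]]
      tendsto_cinner[OF tendsto_const[of x] lim[of y]] LIMSEQ_unique
    unfolding sqrt_iter_symmetric[of B, OF sym] by blast
  moreover have "norm Y \<le> 1"
  proof (rule LIMSEQ_le_const2[OF tendsto_norm[OF Y]])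
    show "\<exists>N. \<forall>n\<ge>N. norm (sqrt_iter B n) \<le> 1"
      using norm_sqrt_iter[OF B] sqrt_iter_bound_range order_trans by blast
  qed
  then have "Re (cinner x (Y x)) \<le> (norm x)\<^sup>2" for x
    using complex_Re_le_cmod[of "cinner x (Y x)"] Cauchy_Schwarz_cinner[of x "Y x"]
      norm_blinfun[of Y x] mult_right_mono[of "norm Y" 1 "norm x"]
      mult_left_mono[of "norm (Y x)" "norm x" "norm x"]
    by (simp add: power2_eq_square)
  ultimately have "positive_bounded R"
    by (simp add: positive_bounded_def R_apply cinner_simps Re_cinner_self)
  moreover have "Z o\<^sub>L R = R o\<^sub>L Z" if ZK: "Z o\<^sub>L K = K o\<^sub>L Z" for Z
  proof -
    have "Z (K x) = K (Z x)" for x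
      using arg_cong[OF ZK, of "\<lambda>F. blinfun_apply F x"] by simp
    then have "Z o\<^sub>L B = B o\<^sub>L Z"
      by (intro blinfun_eqI) (simp add: B_apply blinfun.diff_right)
    then have "(\<lambda>n. sqrt_iter B n o\<^sub>L Z) \<longlonglongrightarrow> (Z o\<^sub>L Y)"
      using tendsto_comp[OF tendsto_const[of Z] Y] by (simp add: sqrt_iter_commute)
    then have "Z o\<^sub>L Y = Y o\<^sub>L Z"
      using tendsto_comp[OF Y tendsto_const[of Z]] LIMSEQ_unique by blast
    then have "Z (Y x) = Y (Z x)" for x
      by (metis blinfun_apply_blinfun_compose)
    then show ?thesis by (intro blinfun_eqI) (simp add: R_apply blinfun.diff_right)
  qed
  ultimately show ?thesis using RR that by blast
qed

lemma positive_bounded_scaleR: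
  "positive_bounded K \<Longrightarrow> 0 \<le> r \<Longrightarrow> positive_bounded (r *\<^sub>R K)"
  by (simp add: positive_bounded_def blinfun.scaleR_left cinner_simps)

text \<open>Scaling reduces this to contractions; \<open>norm K + 1\<close> avoids dividing by zero.\<close>

lemma positive_bounded_sqrt_exists:
  fixes K :: "'h::complex_hilbert \<Rightarrow>\<^sub>L 'h"
  assumes K: "positive_bounded K"
  obtains R where "positive_bounded R" "R o\<^sub>L R = K"
    "\<And>Z. Z o\<^sub>L K = K o\<^sub>L Z \<Longrightarrow> Z o\<^sub>L R = R o\<^sub>L Z"
proof -
  define k where "k = norm K + 1"
  have k: "0 < k" unfolding k_def by (smt (verit) norm_ge_zero)
  have "norm ((1 / k) *\<^sub>R K) \<le> 1" using k by (simp add: k_def)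
  with contraction_sqrt_exists[OF positive_bounded_scaleR[OF K]] k
  obtain R where R: "positive_bounded R" "R o\<^sub>L R = (1 / k) *\<^sub>R K"
    and comm: "\<And>Z. Z o\<^sub>L ((1 / k) *\<^sub>R K) = ((1 / k) *\<^sub>R K) o\<^sub>L Z \<Longrightarrow> Z o\<^sub>L R = R o\<^sub>L Z"
    by (metis less_eq_real_def zero_le_divide_1_iff)
  note scale = bounded_bilinear.scaleR_left[OF bounded_bilinear_blinfun_compose]
    bounded_bilinear.scaleR_right[OF bounded_bilinear_blinfun_compose]
  show ?thesis
  proof (rule that[of "sqrt k *\<^sub>R R"])
    show "positive_bounded (sqrt k *\<^sub>R R)" using R k by (simp add: positive_bounded_scaleR)
    show "(sqrt k *\<^sub>R R) o\<^sub>L (sqrt k *\<^sub>R R) = K" using R k by (simp add: scale)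
    show "Z o\<^sub>L (sqrt k *\<^sub>R R) = (sqrt k *\<^sub>R R) o\<^sub>L Z" if "Z o\<^sub>L K = K o\<^sub>L Z" for Z
      using comm[of Z] that by (simp add: scale)
  qed
qed

lemma positive_bounded_kernel:
  assumes "positive_bounded K" and "Re (cinner x (K x)) = 0"
  shows "K x = 0"
  using positive_bounded_norm_le[OF assms(1), of "norm K + 1" x] assms(2)
  by (simp add: add_nonneg_pos)

text \<open>Since \<open>(R + Q) (R - Q) = 0\<close>, the positive forms of \<open>R\<close> and \<open>Q\<close> both vanish at \<open>y = R x - Q x\<close>, hence
  \<open>R y = Q y = 0\<close> and \<open>\<parallel>y\<parallel>\<^sup>2 = \<langle>x, (R - Q) y\<rangle> = 0\<close>.\<close>

lemma commuting_sqrt_unique: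
  fixes R Q :: "'h::complex_hilbert \<Rightarrow>\<^sub>L 'h"
  assumes R: "positive_bounded R" and Q: "positive_bounded Q"
    and sq: "R o\<^sub>L R = Q o\<^sub>L Q" and comm: "R o\<^sub>L Q = Q o\<^sub>L R"
  shows "R = Q"
proof (rule blinfun_eqI)
  fix x
  have app: "R (R w) = Q (Q w)" "R (Q w) = Q (R w)" for w
    using arg_cong[OF sq, of "\<lambda>F. blinfun_apply F w"] arg_cong[OF comm, of "\<lambda>F. blinfun_apply F w"]
    by simp_all
  define y where "y = R x - Q x"
  have "R y + Q y = 0" by (simp add: y_def blinfun.diff_right app)
  then have "Re (cinner y (R y)) + Re (cinner y (Q y)) = 0"
    by (metis cinner_add_right cinner_zero_right plus_complex.sel(1) zero_complex.sel(1))
  moreover have "0 \<le> Re (cinner y (R y))" "0 \<le> Re (cinner y (Q y))"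
    using R Q by (simp_all add: positive_bounded_def)
  ultimately have "R y = 0" "Q y = 0"
    using positive_bounded_kernel R Q by (metis add_nonneg_eq_0_iff)+
  moreover have "cinner y y = cinner x (R y) - cinner x (Q y)"
    using R Q by (subst (1) y_def) (simp add: positive_bounded_def cinner_diff_left)
  ultimately have "cinner y y = 0" by simp
  then show "R x = Q x" using cinner_self_eq_0D y_def by fastforce
qed

section \<open>Self-adjoint operators and their inverses\<close>

lemma adjoint_operator_eq_Some_iff:
  assumes "densely_defined A"
  shows "adjoint_operator A y = Some z \<longleftrightarrow> (\<forall>x\<in>dom A. cinner y (A \<cdot> x) = cinner z x)"
proof -
  have uniq: "z = z'" if "\<forall>x\<in>dom A. cinner y (A \<cdot> x) = cinner z x"
    "\<forall>x\<in>dom A. cinner y (A \<cdot> x) = cinner z' x" for z z'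
    using assms that dense_cinner_eqI[of "dom A" z z'] by (auto simp: densely_defined_def)
  show ?thesis
  proof (cases "\<exists>z. \<forall>x\<in>dom A. cinner y (A \<cdot> x) = cinner z x")
    case True
    then obtain z' where z': "\<forall>x\<in>dom A. cinner y (A \<cdot> x) = cinner z' x" by blast
    then have "(THE z. \<forall>x\<in>dom A. cinner y (A \<cdot> x) = cinner z x) = z'"
      using uniq by (intro the_equality) blast+
    with True have "adjoint_operator A y = Some z'" by (simp add: adjoint_operator_def)
    then show ?thesis using z' uniq by auto
  qed (auto simp: adjoint_operator_def)
qed

lemma map_eq_iff: "m = m' \<longleftrightarrow> (\<forall>x z. m x = Some z \<longleftrightarrow> m' x = Some z)"
proof
  assume *: "\<forall>x z. m x = Some z \<longleftrightarrow> m' x = Some z"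
  show "m = m'"
  proof
    show "m x = m' x" for x using * by (metis not_None_eq)
  qed
qed simp

lemma self_adjoint_iff:
  "self_adjoint A \<longleftrightarrow> linear_operator A \<and> densely_defined A \<and>
    (\<forall>y z. A y = Some z \<longleftrightarrow> (\<forall>x\<in>dom A. cinner y (A \<cdot> x) = cinner z x))"
  unfolding self_adjoint_def eq_commute[of "adjoint_operator A" A] map_eq_iff
  using adjoint_operator_eq_Some_iff[of A] by (cases "densely_defined A") (simp_all, blast)

lemma self_adjoint_symmetric:
  "self_adjoint A \<Longrightarrow> A x = Some x' \<Longrightarrow> A y = Some y' \<Longrightarrow> cinner x y' = cinner x' y"
  using self_adjoint_iff[of A] by force

text \<open>The symmetry relation with a fixed element of the domain passes to the limit, and an element
  that satisfies it for the whole domain lies in the graph of the adjoint.\<close>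

lemma self_adjoint_closed:
  assumes A: "self_adjoint A" and lim: "u \<longlonglongrightarrow> l" "f \<longlonglongrightarrow> g" and eq: "\<And>n. A (u n) = Some (f n)"
  shows "A l = Some g"
proof -
  have "cinner l (A \<cdot> x) = cinner g x" if "x \<in> dom A" for x
  proof -
    have "cinner (u n) (A \<cdot> x) = cinner (f n) x" for n
      using self_adjoint_symmetric[OF A eq] that by auto
    then show ?thesis
      using tendsto_cinner[OF lim(1) tendsto_const[of "A \<cdot> x"]]
        tendsto_cinner[OF lim(2) tendsto_const[of x]] LIMSEQ_unique by auto
  qed
  then show ?thesis using A by (simp add: self_adjoint_iff)
qed

lemma linear_operatorD:
  assumes "linear_operator A"
  shows linear_operator_zero: "A 0 = Some 0"
    and linear_operator_add: "A x = Some x' \<Longrightarrow> A y = Some y' \<Longrightarrow> A (x + y) = Some (x' + y')"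
    and linear_operator_scaleC: "A x = Some x' \<Longrightarrow> A (a *\<^sub>C x) = Some (a *\<^sub>C x')"
proof -
  note * = assms[unfolded linear_operator_def csubspace_def clinear_on_def]
  show add: "A (x + y) = Some (x' + y')" if xy: "A x = Some x'" "A y = Some y'" for x y x' y'
  proof -
    have "x \<in> dom A" "y \<in> dom A" using xy by (auto intro: domI)
    then have "x + y \<in> dom A" "A \<cdot> (x + y) = A \<cdot> x + A \<cdot> y" using * by blast+
    then show ?thesis using xy by auto
  qed
  show "A (a *\<^sub>C x) = Some (a *\<^sub>C x')" if x: "A x = Some x'" for a x x'
  proof -
    have "x \<in> dom A" using x by (rule domI)
    then have "a *\<^sub>C x \<in> dom A" "A \<cdot> (a *\<^sub>C x) = a *\<^sub>C (A \<cdot> x)" using * by blast+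
    then show ?thesis using x by auto
  qed
  obtain z where z: "A 0 = Some z" using * by blast
  with add[OF z z] show "A 0 = Some 0" by simp
qed

lemma linear_operator_scaleR:
  "linear_operator A \<Longrightarrow> A x = Some x' \<Longrightarrow> A (r *\<^sub>R x) = Some (r *\<^sub>R x')"
  by (simp add: scaleR_scaleC linear_operator_scaleC)

lemma linear_operator_diff:
  "linear_operator A \<Longrightarrow> A x = Some x' \<Longrightarrow> A y = Some y' \<Longrightarrow> A (x - y) = Some (x' - y')"
  using linear_operator_add[of A x x' "- y" "- y'"] linear_operator_scaleR[of A y y' "-1"] by simp

text \<open>Formulated through the graph, so that it says at once that \<open>A\<close> is injective and onto and that
  \<open>dom A\<close> is the range of \<open>T\<close>.\<close>

definition bounded_inverse :: "('h::complex_hilbert \<rightharpoonup> 'h) \<Rightarrow> ('h \<Rightarrow>\<^sub>L 'h) \<Rightarrow> bool"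
  where "bounded_inverse A T \<longleftrightarrow> (\<forall>u f. A u = Some f \<longleftrightarrow> u = T f)"

text \<open>Otherwise there are unit vectors \<open>u\<^sub>n\<close> with \<open>A u\<^sub>n \<longlonglongrightarrow> 0\<close>.  They are the images under the
  compact resolvent of the bounded sequence \<open>A u\<^sub>n - \<zeta> u\<^sub>n\<close>, so a subsequence converges, and as \<open>A\<close> is
  closed the limit is a unit vector in the kernel.\<close>

lemma compact_resolvent_bounded_below:
  fixes A :: "'h::complex_hilbert \<rightharpoonup> 'h"
  assumes A: "self_adjoint A" and cr: "compact_resolvent A"
    and ker: "\<And>u. A u = Some 0 \<Longrightarrow> u = 0"
  obtains c where "0 < c" "\<And>u f. A u = Some f \<Longrightarrow> c * norm u \<le> norm f"
proof (rule ccontr)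
  assume *: "\<not> thesis"
  have lin: "linear_operator A" using A by (simp add: self_adjoint_def)
  have "\<exists>u f. A u = Some f \<and> norm u = 1 \<and> norm f < 1 / Suc n" for n
  proof -
    have "\<not> (\<forall>u f. A u = Some f \<longrightarrow> 1 / Suc n * norm u \<le> norm f)"
      using * that[where c = "1 / Suc n"] by fastforce
    then obtain u f where uf: "A u = Some f" "norm f < 1 / Suc n * norm u"
      by (auto simp: not_le)
    then have "u \<noteq> 0" by auto
    with uf have "A ((1 / norm u) *\<^sub>R u) = Some ((1 / norm u) *\<^sub>R f)"
      "norm ((1 / norm u) *\<^sub>R u) = 1" "norm ((1 / norm u) *\<^sub>R f) < 1 / Suc n"
      by (auto simp: linear_operator_scaleR[OF lin] field_simps)
    then show ?thesis by blast
  qed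
  then obtain u f where u: "\<And>n. A (u n) = Some (f n)" "\<And>n. norm (u n) = 1"
    and f: "\<And>n. norm (f n) < 1 / Suc n" by metis
  obtain \<zeta> where \<zeta>: "\<zeta> \<in> resolvent_set A" "compact_map (resolvent A \<zeta>)"
    using cr by (auto simp: compact_resolvent_def)
  define g where "g n = f n - \<zeta> *\<^sub>C u n" for n
  have "inj_on (\<lambda>u. A \<cdot> u - \<zeta> *\<^sub>C u) (dom A)"
    using \<zeta>(1) by (auto simp: resolvent_set_def bij_betw_def)
  then have ug: "resolvent A \<zeta> (g n) = u n" for n
    unfolding resolvent_def g_def using u(1)[of n]
    by (metis (no_types, lifting) domI inv_into_f_eq option.sel)
  have "bounded (range g)"
  proof (rule boundedI)
    fix x assume "x \<in> range g"
    then obtain n where x: "x = g n" by auto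
    have "norm (f n) < 1" by (rule less_le_trans[OF f]) simp
    then show "norm x \<le> 1 + cmod \<zeta>"
      unfolding x g_def using norm_triangle_ineq4[of "f n" "\<zeta> *\<^sub>C u n"] u(2)[of n]
      unfolding norm_scaleC by simp
  qed
  then have "compact (closure (resolvent A \<zeta> ` range g))"
    using \<zeta>(2) by (simp add: compact_map_def)
  moreover have "u n \<in> closure (resolvent A \<zeta> ` range g)" for n
    unfolding ug[of n, symmetric] by (intro subsetD[OF closure_subset] imageI rangeI)
  ultimately obtain l r where l: "strict_mono r" "(u \<circ> r) \<longlonglongrightarrow> l"
    using compact_imp_seq_compact seq_compactE by metis
  have "f \<longlonglongrightarrow> 0"
  proof (rule Lim_null_comparison)
    show "\<forall>\<^sub>F n in sequentially. norm (f n) \<le> 1 / Suc n"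
      using f by (simp add: less_imp_le)
    show "(\<lambda>n. 1 / real (Suc n)) \<longlonglongrightarrow> 0" by (rule LIMSEQ_Suc) (rule lim_1_over_n)
  qed
  then have "(f \<circ> r) \<longlonglongrightarrow> 0" using l(1) by (rule LIMSEQ_subseq_LIMSEQ)
  with self_adjoint_closed[OF A l(2)] u have "A l = Some 0" by simp
  then have "l = 0" by (rule ker)
  moreover have "norm l = 1"
    using tendsto_norm[OF l(2)] u(2) by (simp add: o_def LIMSEQ_const_iff)
  ultimately show False by simp
qed

text \<open>The lower bound makes the range closed.  The residual of the projection of \<open>f\<close> to the range is
  orthogonal to the range, so it lies in the kernel of the adjoint, which is \<open>A\<close> itself.\<close>

lemma self_adjoint_bounded_below_surj:
  fixes A :: "'h::complex_hilbert \<rightharpoonup> 'h"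
  assumes A: "self_adjoint A" and c: "0 < c" "\<And>u f. A u = Some f \<Longrightarrow> c * norm u \<le> norm f"
  shows "\<exists>u. A u = Some f"
proof -
  have lin: "linear_operator A" using A by (simp add: self_adjoint_def)
  have "csubspace (ran A)"
    unfolding csubspace_def
  proof (intro conjI ballI allI)
    show "0 \<in> ran A" using linear_operator_zero[OF lin] by (rule ranI)
    show "x + y \<in> ran A" if "x \<in> ran A" "y \<in> ran A" for x y
      using that linear_operator_add[OF lin] by (fastforce simp: ran_def)
    show "a *\<^sub>C x \<in> ran A" if "x \<in> ran A" for a x
      using that linear_operator_scaleC[OF lin] by (fastforce simp: ran_def)
  qed
  moreover have "closed (ran A)"
    unfolding closed_sequential_limits
  proof (intro allI impI)
    fix g l assume gl: "(\<forall>n. g n \<in> ran A) \<and> g \<longlonglongrightarrow> l"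
    then obtain u where u: "\<And>n. A (u n) = Some (g n)"
      unfolding ran_def by simp metis
    have "Cauchy u"
    proof (rule metric_CauchyI)
      fix e :: real assume "0 < e"
      then have "0 < c * e" using c by simp
      moreover have "Cauchy g" using gl LIMSEQ_imp_Cauchy by blast
      ultimately obtain N where N: "\<And>m n. N \<le> m \<Longrightarrow> N \<le> n \<Longrightarrow> dist (g m) (g n) < c * e"
        unfolding Cauchy_def by blast
      have "dist (u m) (u n) < e" if "N \<le> m" "N \<le> n" for m n
      proof -
        have "c * norm (u m - u n) < c * e"
          using c(2)[OF linear_operator_diff[OF lin u u], of m n] N[OF that]
          by (simp add: dist_norm)
        then show ?thesis using c(1) by (simp add: dist_norm)
      qed
      then show "\<exists>N. \<forall>m\<ge>N. \<forall>n\<ge>N. dist (u m) (u n) < e" by blast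
    qed
    then obtain v where "u \<longlonglongrightarrow> v" using Cauchy_convergent convergent_def by blast
    with gl u have "A v = Some l" using self_adjoint_closed[OF A] by blast
    then show "l \<in> ran A" by (rule ranI)
  qed
  ultimately obtain w where w: "w \<in> ran A" "\<And>m. m \<in> ran A \<Longrightarrow> cinner m (f - w) = 0"
    using orthogonal_projection_exists by blast
  have "cinner (f - w) (A \<cdot> x) = cinner 0 x" if "x \<in> dom A" for x
  proof -
    have "A \<cdot> x \<in> ran A" using that by (auto intro: ranI)
    from w(2)[OF this] show ?thesis by (subst cinner_commute) simp
  qed
  then have "A (f - w) = Some 0" using A by (simp add: self_adjoint_iff)
  from c(2)[OF this] c(1) have "f = w" by (simp add: mult_le_0_iff)
  with w(1) show ?thesis by (auto simp: ran_def)
qed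

lemma self_adjoint_bounded_inverse:
  fixes A :: "'h::complex_hilbert \<rightharpoonup> 'h"
  assumes A: "self_adjoint A" and nonneg: "nonnegative_operator A"
    and c: "0 < c" "\<And>u f. A u = Some f \<Longrightarrow> c * norm u \<le> norm f"
  obtains T where "positive_bounded T" "bounded_inverse A T"
proof -
  have lin: "linear_operator A" using A by (simp add: self_adjoint_def)
  obtain t where t: "\<And>f. A (t f) = Some f"
    using self_adjoint_bounded_below_surj[OF A c] by metis
  have inj: "u = v" if "A u = Some f" "A v = Some f" for u v f
    using c(2)[OF linear_operator_diff[OF lin that]] c(1) by (simp add: mult_le_0_iff)
  have "bounded_linear t"
  proof (rule bounded_linear_intro[where K = "1 / c"])
    show "t (x + y) = t x + t y" for x y
      using inj[OF t linear_operator_add[OF lin t t]] .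
    show "t (r *\<^sub>R x) = r *\<^sub>R t x" for r x
      using inj[OF t linear_operator_scaleR[OF lin t]] .
    show "norm (t x) \<le> norm x * (1 / c)" for x
      using c(2)[OF t, of x] c(1) by (simp add: field_simps)
  qed
  then have apply_T: "Blinfun t x = t x" for x by (simp add: bounded_linear_Blinfun_apply)
  show ?thesis
  proof (rule that[of "Blinfun t"])
    show "bounded_inverse A (Blinfun t)"
      unfolding bounded_inverse_def apply_T using t inj by metis
    have "0 \<le> Re (cinner x (t x))" for x
      using nonneg t[of x] Re_cinner_commute[of x "t x"]
      unfolding nonnegative_operator_def by (metis domI option.sel)
    moreover have "cinner (t x) y = cinner x (t y)" for x y
      using self_adjoint_symmetric[OF A t[of x] t[of y]] .
    ultimately show "positive_bounded (Blinfun t)"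
      unfolding positive_bounded_def apply_T by blast
  qed
qed

section \<open>The square root of a self-adjoint operator with bounded inverse\<close>

text \<open>Testing \<open>\<langle>y, S x\<rangle> = \<langle>z, x\<rangle>\<close> on all \<open>x = R w\<close> says \<open>\<langle>y, w\<rangle> = \<langle>R z, w\<rangle>\<close> for all \<open>w\<close>, that is
  \<open>y = R z\<close>; so the adjoint has the same graph as \<open>S\<close>.\<close>

lemma self_adjoint_of_bounded_inverse:
  fixes S :: "'h::complex_hilbert \<rightharpoonup> 'h"
  assumes R: "positive_bounded R" and S: "bounded_inverse S R" and dense: "densely_defined S"
  shows "self_adjoint S" "nonnegative_operator S"
proof -
  have inv: "S u = Some f \<longleftrightarrow> u = R f" for u f using S by (simp add: bounded_inverse_def)
  have dom: "dom S = range R" unfolding dom_def using inv by auto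
  have app: "S \<cdot> (R f) = f" for f using inv[of "R f" f] by simp
  have sym: "cinner (R x) y = cinner x (R y)" for x y using R by (simp add: positive_bounded_def)
  have scaleC: "R (a *\<^sub>C x) = a *\<^sub>C R x" for a x
    by (rule cinner_eqI) (simp add: sym cinner_simps)
  have add: "R (x + y) = R x + R y" for x y by (rule blinfun.add_right)
  have "csubspace (dom S)"
    unfolding csubspace_def dom
    by (auto simp: add[symmetric] scaleC[symmetric] intro: range_eqI[of 0 _ 0])
  moreover have "clinear_on (dom S) (\<lambda>x. S \<cdot> x)"
    unfolding clinear_on_def by (auto simp: dom app add[symmetric] scaleC[symmetric])
  moreover have "S y = Some z \<longleftrightarrow> (\<forall>x\<in>dom S. cinner y (S \<cdot> x) = cinner z x)" for y z
    unfolding inv using cinner_eqI[of y "R z"] by (auto simp: dom app sym)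
  ultimately show "self_adjoint S"
    using dense by (auto simp: self_adjoint_iff linear_operator_def)
  show "nonnegative_operator S"
    unfolding nonnegative_operator_def using R
    by (auto simp: dom app sym positive_bounded_def)
qed

text \<open>Existence: the inverse \<open>S\<close> of the positive square root \<open>R\<close> of \<open>T = A\<^sup>-\<^sup>1\<close>.  Uniqueness: for any other
  root \<open>S'\<close> and \<open>x = S' u\<close> one has \<open>u = S' (T x)\<close>, hence \<open>\<parallel>u\<parallel>\<^sup>2 = \<langle>S' T x, u\<rangle> = \<langle>T x, x\<rangle>\<close>.  So \<open>S'\<close> is
  bounded below and has a bounded positive inverse \<open>Q\<close> with \<open>Q\<^sup>2 = T\<close>; as \<open>Q\<close> commutes with \<open>T\<close>, it
  commutes with \<open>R\<close> and equals \<open>R\<close>.\<close>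

lemma sqrt_operator_bounded_inverse:
  fixes A :: "'h::complex_hilbert \<rightharpoonup> 'h"
  assumes A: "self_adjoint A" and T: "positive_bounded T" "bounded_inverse A T"
  obtains R where "bounded_inverse (sqrt_operator A) R" "self_adjoint (sqrt_operator A)"
    "sqrt_operator A \<circ>\<^sub>m sqrt_operator A = A"
proof -
  have invA: "A u = Some f \<longleftrightarrow> u = T f" for u f using T by (simp add: bounded_inverse_def)
  have injT: "f = g" if "T f = T g" for f g using invA that by (metis option.sel)
  obtain R where R: "positive_bounded R" "R o\<^sub>L R = T"
    and comm: "\<And>Z. Z o\<^sub>L T = T o\<^sub>L Z \<Longrightarrow> Z o\<^sub>L R = R o\<^sub>L Z"
    using positive_bounded_sqrt_exists[OF T(1)] by blast
  have RR: "R (R x) = T x" for x using R(2) by (metis blinfun_apply_blinfun_compose)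
  have injR: "f = g" if "R f = R g" for f g using injT RR that by metis
  define S where "S u = (if u \<in> range R then Some (inv R u) else None)" for u
  have S: "bounded_inverse S R"
    unfolding bounded_inverse_def S_def
    using injR by (auto simp: f_inv_into_f)
  have invS: "S u = Some f \<longleftrightarrow> u = R f" for u f using S by (simp add: bounded_inverse_def)
  have "dom A \<subseteq> dom S" using invA invS RR by (metis domD domI subsetI)
  then have "densely_defined S"
    using A closure_mono unfolding self_adjoint_def densely_defined_def by blast
  note sa = self_adjoint_of_bounded_inverse[OF R(1) S this]
  have SS: "S \<circ>\<^sub>m S = A"
  proof
    fix u
    have "(S \<circ>\<^sub>m S) u = Some w \<longleftrightarrow> A u = Some w" for w
      unfolding map_comp_Some_iff invS invA by (auto simp: RR)
    then show "(S \<circ>\<^sub>m S) u = A u" by (metis not_None_eq)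
  qed
  have "S' = S" if S': "self_adjoint S'" "nonnegative_operator S'" "S' \<circ>\<^sub>m S' = A" for S'
  proof -
    have lin: "linear_operator S'" using S' by (simp add: self_adjoint_def)
    have comp: "A u = Some w \<longleftrightarrow> (\<exists>v. S' u = Some v \<and> S' v = Some w)" for u w
      using map_comp_Some_iff[of S' S' u w] S'(3) by auto
    have inj: "u = v" if "S' u = Some f" "S' v = Some f" for u v f
    proof -
      have "S' (u - v) = Some 0" using linear_operator_diff[OF lin that] by simp
      then have "A (u - v) = Some 0" using comp linear_operator_zero[OF lin] by blast
      then show ?thesis by (simp add: invA blinfun.zero_right)
    qed
    define k where "k = sqrt (norm T) + 1"
    have k: "0 < k" by (simp add: k_def add_nonneg_pos)
    \<comment> \<open>The summand \<open>1\<close> in \<open>k\<close> only makes it nonzero.\<close>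
    have bound: "1 / k * norm u \<le> norm x" if u: "S' u = Some x" for u x
    proof -
      obtain v where v: "S' (T x) = Some v" "S' v = Some x" using comp invA by blast
      then have "S' (T x) = Some u" using inj[OF u v(2)] by simp
      from self_adjoint_symmetric[OF S'(1) this u]
      have "(norm u)\<^sup>2 = Re (cinner (T x) x)" by (simp add: Re_cinner_self)
      also have "\<dots> \<le> norm (T x) * norm x"
        using complex_Re_le_cmod Cauchy_Schwarz_cinner order_trans by blast
      also have "\<dots> \<le> (norm T * norm x) * norm x"
        by (intro mult_right_mono norm_blinfun) simp
      also have "\<dots> = (sqrt (norm T) * norm x)\<^sup>2"
        by (simp add: power_mult_distrib power2_eq_square[of "norm x"])
      finally have "norm u \<le> sqrt (norm T) * norm x" by (rule power2_le_imp_le) simp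
      also have "\<dots> \<le> k * norm x" by (intro mult_right_mono) (simp_all add: k_def)
      finally show ?thesis using k by (simp add: field_simps)
    qed
    obtain Q where Q: "positive_bounded Q" "bounded_inverse S' Q"
      using self_adjoint_bounded_inverse[OF S'(1,2), of "1 / k"] bound k by auto
    have invS': "S' u = Some f \<longleftrightarrow> u = Q f" for u f using Q by (simp add: bounded_inverse_def)
    have QQ: "Q o\<^sub>L Q = T"
    proof (rule blinfun_eqI)
      fix x
      have "A (Q (Q x)) = Some x" unfolding comp invS' by blast
      then show "(Q o\<^sub>L Q) x = T x" by (simp add: invA)
    qed
    then have "Q o\<^sub>L T = T o\<^sub>L Q" by (intro blinfun_eqI) (simp add: QQ[symmetric])
    from comm[OF this] have "R = Q"
      using commuting_sqrt_unique[OF R(1) Q(1)] R(2) QQ by metis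
    then have "S' u = Some f \<longleftrightarrow> S u = Some f" for u f by (simp add: invS invS')
    then show ?thesis by (metis not_None_eq ext)
  qed
  then have "sqrt_operator A = S"
    unfolding sqrt_operator_def using sa SS by (intro the_equality) blast+
  with S sa SS show ?thesis using that by metis
qed

section \<open>The resolvent estimate\<close>

lemma Sigma_d_reciprocal:
  assumes d0: "\<delta>\<^sub>0 \<in> Sigma_d" and b: "0 \<le> b"
  shows "(\<lambda>l. inverse (4 / \<delta>\<^sub>0 l * (1 + b * l\<^sup>2) + 2 * b)) \<in> Sigma_d"
proof -
  have pos: "0 < \<delta>\<^sub>0 x" for x using d0 by (simp add: Sigma_d_def)
  have *: "0 < 4 / \<delta>\<^sub>0 x * (1 + b * x\<^sup>2) + 2 * b" for x
    using pos[of x] b by (intro add_pos_nonneg mult_pos_pos) (auto intro: add_pos_nonneg)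
  have "continuous_on UNIV \<delta>\<^sub>0" using d0 by (simp add: Sigma_d_def)
  then have "continuous_on UNIV (\<lambda>l. inverse (4 / \<delta>\<^sub>0 l * (1 + b * l\<^sup>2) + 2 * b))"
    using * pos by (intro continuous_intros) (auto simp: less_imp_neq[symmetric])
  moreover have "antimono_on {0..} (\<lambda>l. inverse (4 / \<delta>\<^sub>0 l * (1 + b * l\<^sup>2) + 2 * b))"
  proof (rule monotone_onI)
    fix x y :: real assume xy: "x \<in> {0..}" "y \<in> {0..}" "x \<le> y"
    then have "\<delta>\<^sub>0 y \<le> \<delta>\<^sub>0 x" using d0 by (auto simp: Sigma_d_def monotone_on_def)
    then have "4 / \<delta>\<^sub>0 x \<le> 4 / \<delta>\<^sub>0 y" using pos by (intro divide_left_mono) auto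
    then have "4 / \<delta>\<^sub>0 x * (1 + b * x\<^sup>2) \<le> 4 / \<delta>\<^sub>0 y * (1 + b * y\<^sup>2)"
      using xy b pos[of y] by (intro mult_mono add_left_mono mult_left_mono power_mono)
        (auto intro!: add_nonneg_nonneg)
    then show "inverse (4 / \<delta>\<^sub>0 x * (1 + b * x\<^sup>2) + 2 * b)
        \<ge> inverse (4 / \<delta>\<^sub>0 y * (1 + b * y\<^sup>2) + 2 * b)"
      using * by (intro le_imp_inverse_le) auto
  qed
  ultimately show ?thesis using d0 * by (simp add: Sigma_d_def)
qed

theorem theorem3p1:
  fixes A\<^sub>0 :: "'h::complex_hilbert \<rightharpoonup> 'h"
    and C\<^sub>0 :: "'h \<Rightarrow> 'y::complex_hilbert"
    and \<delta>\<^sub>0 :: "real \<Rightarrow> real"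
  assumes "unbounded_operator A\<^sub>0" and "self_adjoint A\<^sub>0" and "positive_operator A\<^sub>0"
    and "compact_resolvent A\<^sub>0"
    and "bounded_observation A\<^sub>0 C\<^sub>0"
    and "admissible A\<^sub>0 C\<^sub>0"
    and "\<delta>\<^sub>0 \<in> Sigma_d"
    and "\<And>(\<omega>::real) u. u \<in> dom A\<^sub>0 \<Longrightarrow>
      \<delta>\<^sub>0 \<omega> * (\<omega>\<^sup>2 * (norm u)\<^sup>2 + (norm (sqrt_operator A\<^sub>0 \<cdot> u))\<^sup>2)
        \<le> (norm (A\<^sub>0 \<cdot> u - \<omega>\<^sup>2 *\<^sub>R u))\<^sup>2 + (norm (C\<^sub>0 u))\<^sup>2"
  shows "\<exists>\<delta>\<in>Sigma_d. \<forall>l::real. \<forall>z\<in>dom (A_op A\<^sub>0).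
      \<delta> l * (X_norm A\<^sub>0 z)\<^sup>2
        \<le> (X_norm A\<^sub>0 (A_op A\<^sub>0 \<cdot> z - l *\<^sub>R z))\<^sup>2 + (norm (C_op C\<^sub>0 z))\<^sup>2"
proof -
  define S where "S = sqrt_operator A\<^sub>0"
  have nonneg: "nonnegative_operator A\<^sub>0"
    using assms(3) unfolding nonnegative_operator_def positive_operator_def
    by (metis cinner_zero_left less_eq_real_def zero_complex.sel(1))
  have ker: "u = 0" if "A\<^sub>0 u = Some 0" for u
    using assms(3) that unfolding positive_operator_def
    by (metis cinner_zero_right domI less_irrefl option.sel zero_complex.sel(1))
  obtain c where "0 < c" "\<And>u f. A\<^sub>0 u = Some f \<Longrightarrow> c * norm u \<le> norm f"
    using compact_resolvent_bounded_below[OF assms(2,4) ker] by blast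
  then obtain T where "positive_bounded T" "bounded_inverse A\<^sub>0 T"
    using self_adjoint_bounded_inverse[OF assms(2) nonneg] by blast
  then obtain R where R: "bounded_inverse S R" and S: "self_adjoint S" "S \<circ>\<^sub>m S = A\<^sub>0"
    unfolding S_def using sqrt_operator_bounded_inverse[OF assms(2)] by blast
  have lin: "linear_operator S" using S by (simp add: self_adjoint_def)
  define b where "b = (norm R)\<^sup>2"
  have b: "0 \<le> b" by (simp add: b_def)
  have S_bound: "(norm f)\<^sup>2 \<le> b * (norm (S \<cdot> f))\<^sup>2" if "f \<in> dom S" for f
  proof -
    have "S f = Some (S \<cdot> f)" using that by auto
    then have "f = R (S \<cdot> f)" using R by (simp only: bounded_inverse_def)
    then have "norm f \<le> norm R * norm (S \<cdot> f)" using norm_blinfun[of R "S \<cdot> f"] by simp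
    then show ?thesis
      unfolding b_def power_mult_distrib[symmetric] by (intro power_mono) auto
  qed
  define \<delta> where "\<delta> l = inverse (4 / \<delta>\<^sub>0 l * (1 + b * l\<^sup>2) + 2 * b)" for l
  have "\<delta> \<in> Sigma_d"
    unfolding \<delta>_def using Sigma_d_reciprocal[OF assms(7) b] .
  moreover have "\<delta> l * (X_norm A\<^sub>0 z)\<^sup>2
        \<le> (X_norm A\<^sub>0 (A_op A\<^sub>0 \<cdot> z - l *\<^sub>R z))\<^sup>2 + (norm (C_op C\<^sub>0 z))\<^sup>2"
    if z: "z \<in> dom (A_op A\<^sub>0)" for l z
  proof -
    obtain u v where uv: "z = (u, v)" "u \<in> dom A\<^sub>0" "v \<in> dom S"
      using z by (cases z) (auto simp: A_op_def S_def split: if_splits)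
    define f where "f = - (\<i> *\<^sub>C v) - l *\<^sub>R u"
    define g where "g = \<i> *\<^sub>C (A\<^sub>0 \<cdot> u) - l *\<^sub>R v"
    have Az: "A_op A\<^sub>0 \<cdot> z - l *\<^sub>R z = (f, g)"
      using uv by (simp add: A_op_def f_def g_def S_def)
    have "u \<in> dom S" using uv(2) S(2) by (auto simp: map_comp_Some_iff dom_def)
    then have "f \<in> dom S"
      using uv(3) linear_operator_diff[OF lin linear_operator_scaleC[OF lin]
          linear_operator_scaleR[OF lin], of v _ u _ "- \<i>" l]
        scaleR_scaleC[of "-1" "\<i> *\<^sub>C v"]
      by (auto simp: f_def scaleC_scaleC dom_def)
    then have f: "(norm f)\<^sup>2 \<le> b * (norm (S \<cdot> f))\<^sup>2" by (rule S_bound)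
    note scaleC = scaleC_diff_right scaleC_minus_right scaleC_scaleR ii_scaleC_ii_scaleC
    have v: "v = \<i> *\<^sub>C f + l *\<^sub>R (\<i> *\<^sub>C u)"
      by (simp add: f_def scaleC)
    have A0u: "A\<^sub>0 \<cdot> u - l\<^sup>2 *\<^sub>R u = l *\<^sub>R f + - (\<i> *\<^sub>C g)"
      by (simp add: f_def g_def scaleC power2_eq_square algebra_simps)
    have pos: "0 < \<delta>\<^sub>0 l" using assms(7) by (simp add: Sigma_d_def)
    define F G U V W where "F = (norm (S \<cdot> f))\<^sup>2" and "G = (norm g)\<^sup>2" and "U = (norm u)\<^sup>2"
      and "V = (norm (S \<cdot> u))\<^sup>2" and "W = (norm (C\<^sub>0 u))\<^sup>2"
    note defs = F_def G_def U_def V_def W_def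
    have nonneg: "0 \<le> F" "0 \<le> G" "0 \<le> V" "0 \<le> W" by (simp_all add: defs)
    have "(norm v)\<^sup>2 \<le> 2 * (norm f)\<^sup>2 + 2 * (l\<^sup>2 * U)"
      unfolding v U_def by (rule order_trans[OF power2_norm_add_le])
        (simp add: norm_scaleC power_mult_distrib)
    then have v_le: "(norm v)\<^sup>2 \<le> 2 * (b * F) + 2 * (l\<^sup>2 * U)"
      using f by (simp add: F_def)
    have "(norm (A\<^sub>0 \<cdot> u - l\<^sup>2 *\<^sub>R u))\<^sup>2 \<le> 2 * (l\<^sup>2 * (norm f)\<^sup>2) + 2 * G"
      unfolding A0u G_def by (rule order_trans[OF power2_norm_add_le])
        (simp add: norm_scaleC power_mult_distrib)
    also have "\<dots> \<le> 2 * (l\<^sup>2 * (b * F)) + 2 * G"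
      using f by (simp add: F_def mult_left_mono)
    finally have "\<delta>\<^sub>0 l * (l\<^sup>2 * U + V) \<le> 2 * (l\<^sup>2 * (b * F)) + 2 * G + W"
      using assms(8)[OF uv(2), of l] by (simp add: defs S_def)
    also have "\<dots> \<le> 2 * (1 + b * l\<^sup>2) * (F + G + W)"
      using nonneg b by (simp add: algebra_simps)
    finally have "2 * (l\<^sup>2 * U + V) \<le> 4 / \<delta>\<^sub>0 l * (1 + b * l\<^sup>2) * (F + G + W)"
      using pos by (simp add: field_simps)
    moreover have "2 * (b * F) \<le> 2 * b * (F + G + W)"
      using nonneg b by (simp add: algebra_simps)
    ultimately have "V + (norm v)\<^sup>2 \<le> (4 / \<delta>\<^sub>0 l * (1 + b * l\<^sup>2) + 2 * b) * (F + G + W)"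
      using v_le nonneg by (simp add: distrib_right)
    moreover have "0 < 4 / \<delta>\<^sub>0 l * (1 + b * l\<^sup>2) + 2 * b"
      using pos b by (intro add_pos_nonneg mult_pos_pos) (auto intro: add_pos_nonneg)
    ultimately have "\<delta> l * (V + (norm v)\<^sup>2) \<le> F + G + W"
      unfolding \<delta>_def by (simp add: inverse_eq_divide pos_divide_le_eq mult.commute)
    then show ?thesis
      unfolding Az by (simp add: uv(1) X_norm_def C_op_def defs S_def)
  qed
  ultimately show ?thesis by blast
qed

end
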